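(* For every $n\in\mathbb N$ (positive integer) there exists a continuous cubes preserving function $f_n$ from $[0,1]$ onto $[0,1]^n$ with the following property: if $[a,b],[b,c]\in K^1_{ns}$ for some $s\in\mathbb N$, then $f_n([a,b])$ and $f_n([b,c])$ are elements of $K^n_s$ which have an $(n-1)$-dimensional face of side $\frac{1}{2^s}$ in common, and $f_n(b)$ is a vertex of that common face.
   Context: For $n\ge 1$ and $s\ge 0$, $K^n_s$ denotes the set of the $2^{ns}$ closed dyadic subcubes of $[0,1]^n$ of side $2^{-s}$: $K^n_0=\{[0,1]^n\}$, and $K^n_s$ is obtained by dividing each cube of $K^n_{s-1}$ into $2^n$ closed congruent cubes of side $2^{-s}$. In particular $K^1_{ns}$ is the set of closed dyadic subintervals of $[0,1]$ of length $2^{-ns}$. A function $f:[0,1]\to[0,1]^n$ is called cubes preserving if for every $s\in\mathbb N$: (i) for every $\alpha\in K^1_{ns}$ there is $\delta\in K^n_s$ with $f(\alpha)\subseteq\delta$; and (ii) for every $\delta\in K^n_s$ there is $\alpha\in K^1_{ns}$ with $f^{-1}(\operatorname{int}(\delta))\subseteq\alpha$, where $\operatorname{int}(\delta)$ is the set of interior points of $\delta$. For $n=1$ a $0$-dimensional face is a single endpoint, which is its own vertex. *)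

theory Defs
  imports "HOL-Analysis.Analysis"
begin

(* For 'a = real^'n this is K^n_s; for 'a = real it is K^1_s (there Basis = {1} and cbox a b = {a..b}). *)
definition dyadic_cubes :: "nat \<Rightarrow> 'a::euclidean_space set set" where
  "dyadic_cubes s =
     {cbox (\<Sum>i\<in>Basis. (real (k i) / 2 ^ s) *\<^sub>R i) (\<Sum>i\<in>Basis. ((real (k i) + 1) / 2 ^ s) *\<^sub>R i) | k.
        \<forall>i\<in>Basis. k i < 2 ^ s}"

(* Functions on [0,1] are total functions on the reals of which only the values on {0..1} matter.
   The interior is the one in the ambient space R^n, not relative to the unit cube. *)
definition cubes_preserving :: "(real \<Rightarrow> real ^ 'n) \<Rightarrow> bool" where
  "cubes_preserving f \<longleftrightarrow>
     f ` {0..1} \<subseteq> cbox 0 1 \<and>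
     (\<forall>s. (\<forall>\<alpha> \<in> dyadic_cubes (CARD('n) * s). \<exists>\<delta> \<in> dyadic_cubes s. f ` \<alpha> \<subseteq> \<delta>) \<and>
          (\<forall>\<delta> \<in> dyadic_cubes s. \<exists>\<alpha> \<in> dyadic_cubes (CARD('n) * s).
              {t \<in> {0..1}. f t \<in> interior \<delta>} \<subseteq> \<alpha>))"

(* Closed axis-parallel d-dimensional cube of side r in R^n; for d = 0 it is a single point. *)
definition axis_cube :: "nat \<Rightarrow> real \<Rightarrow> (real ^ 'n) set \<Rightarrow> bool" where
  "axis_cube d r F \<longleftrightarrow>
     (\<exists>u I. card I = d \<and> F = cbox u (u + (\<chi> i. if i \<in> I then r else 0)))"

end

theory Submission
  imports Defs
begin

text \<open>
  The function is the \<open>n\<close>-dimensional Hilbert curve. At level \<open>s\<close> the cubes of side \<open>2 ^ - s\<close> are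
  listed in an order \<open>C s 0, C s 1, \<dots>\<close> in which consecutive cubes share a facet, together with lattice
  points \<open>V s 0, V s 1, \<dots>\<close> such that \<open>V s k\<close> and \<open>V s (k + 1)\<close> are the ends of an edge of \<open>C s k\<close>. The
  curve runs through the cube \<open>C s k\<close> during the \<open>k\<close>-th dyadic interval, entering it at \<open>V s k\<close> and
  leaving it at \<open>V s (k + 1)\<close>. A point at which the curve passes from one cube to the next is thus a
  vertex of both cubes, so it is a vertex of their common facet.

  Everything rests on the passage from one level to the next: for every cube and every edge \<open>x y\<close> of
  it, the \<open>2 ^ n\<close> half-size subcubes can be traversed in such an order, along edges of the subcubes,
  from \<open>x\<close> to \<open>y\<close> (\<open>subdivide_edge\<close>). Such a traversal is built by adding one coordinate at a time,
  with the direction of \<open>x y\<close> last (\<open>grid_path_double\<close>). Given a path through the subcubes of a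
  lower-dimensional block, run through it at the level \<open>2 x\<^sub>j\<close> of the new coordinate \<open>j\<close>, up to the
  entry of the last cube. There make two steps in direction \<open>j\<close>, through that cube to the middle level
  and through the next cube to the opposite level. Then retrace the path backwards at that level.
  The cubes are visited in the order of the reflected Gray code, and the path ends opposite to its
  starting point in direction \<open>j\<close>.

  Paths in two consecutive cubes \<open>c\<close> and \<open>c'\<close> that meet in a vertex \<open>w\<close> fit together, because the
  subcube of \<open>c\<close> at \<open>w\<close> has the coordinates \<open>c + w\<close> in the refined grid, and that of \<open>c'\<close> has \<open>c' + w\<close>:
  they are neighbours because \<open>c\<close> and \<open>c'\<close> are (\<open>curve_level_refine\<close>).

  The curve is the limit of the vertices \<open>V m q / 2 ^ m\<close>, where \<open>q\<close> is the number of the level-\<open>m\<close> interval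
  of \<open>t\<close>. Since the levels are nested, it maps each dyadic interval into the cube of the same number
  (\<open>curve_in_cell\<close>); as consecutive cubes meet, this gives continuity. It passes through every
  smaller subcube of that cube, so by compactness the image is the whole cube
  (\<open>curve_image_cell\<close>). Since different intervals belong to different cubes, the preimage of the
  interior of a cube lies in a single interval.
\<close>

section \<open>Paths through the subcubes of a cube\<close>

text \<open>
  In a grid of unit cubes, a function \<open>c\<close> stands for the cube with the sides \<open>[c j, c j + 1]\<close>, and a
  function \<open>x\<close> in a vertex position for the lattice point with the coordinates \<open>x j\<close>.
\<close>

definition corner :: "('n \<Rightarrow> nat) \<Rightarrow> ('n \<Rightarrow> nat) \<Rightarrow> bool" where
  "corner c x \<longleftrightarrow> (\<forall>j. x j = c j \<or> x j = Suc (c j))"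

text \<open>
  The map \<open>v \<mapsto> 2 * c d + 1 - v\<close> exchanges the two values \<open>c d\<close> and \<open>c d + 1\<close> of the \<open>d\<close>-th coordinate,
  so \<open>y\<close> is the vertex of \<open>c\<close> that is joined to \<open>x\<close> by the edge in direction \<open>d\<close>.
\<close>

definition edge :: "('n \<Rightarrow> nat) \<Rightarrow> ('n \<Rightarrow> nat) \<Rightarrow> ('n \<Rightarrow> nat) \<Rightarrow> bool" where
  "edge c x y \<longleftrightarrow> corner c x \<and> (\<exists>d. y = x(d := 2 * c d + 1 - x d))"

definition adjacent :: "('n \<Rightarrow> nat) \<Rightarrow> ('n \<Rightarrow> nat) \<Rightarrow> bool" where
  "adjacent a b \<longleftrightarrow> (\<exists>d. (a d = Suc (b d) \<or> b d = Suc (a d)) \<and> (\<forall>j. j \<noteq> d \<longrightarrow> a j = b j))"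

text \<open>
  The subcubes of \<open>c\<close> in the grid of half the side, in the coordinates of that finer grid.
\<close>

definition children :: "('n \<Rightarrow> nat) \<Rightarrow> ('n \<Rightarrow> nat) set" where
  "children c = {h. \<forall>j. h j div 2 = c j}"

lemma edge_start: "edge c x y \<Longrightarrow> corner c x"
  by (simp add: edge_def)

lemma edge_end:
  assumes "edge c x y"
  shows "corner c y"
proof -
  obtain d where y: "y = x(d := 2 * c d + 1 - x d)" using assms by (auto simp: edge_def)
  have x: "x j = c j \<or> x j = Suc (c j)" for j
    using assms by (auto simp: edge_def corner_def)
  have "y j = c j \<or> y j = Suc (c j)" for j
    using x[of j] by (cases "j = d") (auto simp: y)
  then show ?thesis by (simp add: corner_def)
qed

lemma edge_commute: "edge c x y \<Longrightarrow> edge c y x"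
proof -
  assume e: "edge c x y"
  then obtain d where d: "y = x(d := 2 * c d + 1 - x d)" by (auto simp: edge_def)
  have "x d = c d \<or> x d = Suc (c d)" using e by (auto simp: edge_def corner_def)
  then have "x = y(d := 2 * c d + 1 - y d)" using d by (auto simp: fun_eq_iff)
  then show ?thesis using edge_end[OF e] by (auto simp: edge_def)
qed

text \<open>
  An edge along which coordinate \<open>j\<close> does not move may be shifted in that coordinate, as long as it
  stays on one of the two sides \<open>h\<close> and \<open>h + 1\<close> of the shifted cube.
\<close>

lemma edge_fun_upd:
  assumes "edge c x y" and "x j = y j" and "w = h \<or> w = Suc h"
  shows "edge (c(j := h)) (x(j := w)) (y(j := w))"
proof -
  obtain d where d: "y = x(d := 2 * c d + 1 - x d)" using assms by (auto simp: edge_def)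
  have "x d = c d \<or> x d = Suc (c d)" using assms by (auto simp: edge_def corner_def)
  \<comment> \<open>Reflection in coordinate \<open>d\<close> has no fixed point, so the moving coordinate is not \<open>j\<close>.\<close>
  then have "d \<noteq> j" using d assms(2) by (auto simp: fun_eq_iff)
  then have "y(j := w) = (x(j := w))(d := 2 * (c(j := h)) d + 1 - (x(j := w)) d)"
    using d by (auto simp: fun_eq_iff)
  then show ?thesis using assms by (auto simp: edge_def corner_def)
qed

lemma adjacent_commute: "adjacent a b \<Longrightarrow> adjacent b a"
  unfolding adjacent_def by metis

lemma adjacent_fun_upd:
  assumes "adjacent a b" and "a j = b j"
  shows "adjacent (a(j := w)) (b(j := w))"
proof -
  obtain d where d: "a d = Suc (b d) \<or> b d = Suc (a d)" "\<forall>i. i \<noteq> d \<longrightarrow> a i = b i"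
    using assms by (auto simp: adjacent_def)
  then show ?thesis unfolding adjacent_def
    by (intro exI[of _ d]) (use assms(2) in auto)
qed

text \<open>
  A face of the cube of subcubes: all subcubes of \<open>c\<close> that lie on the same side as the vertex \<open>x\<close> in the
  coordinates outside \<open>I\<close>. In each coordinate the subcube next to \<open>x\<close> has the number \<open>c j + x j\<close>, since
  this is \<open>2 * c j\<close> when \<open>x j = c j\<close> and \<open>2 * c j + 1\<close> when \<open>x j = c j + 1\<close>.
\<close>

definition block :: "('n \<Rightarrow> nat) \<Rightarrow> ('n \<Rightarrow> nat) \<Rightarrow> 'n set \<Rightarrow> ('n \<Rightarrow> nat) set" where
  "block c x I = {h. \<forall>j. if j \<in> I then h j div 2 = c j else h j = c j + x j}"

text \<open>
  Freeing a coordinate doubles the block; since the two numbers \<open>2 * c j\<close> and \<open>2 * c j + 1\<close> add up to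
  \<open>4 * c j + 1\<close>, the reflection takes \<open>c j + x j\<close> to \<open>3 * c j + 1 - x j\<close>.
\<close>

lemma block_insert:
  assumes "corner c x" "j \<notin> I"
  shows "block c x (insert j I) = block c x I \<union> (\<lambda>h. h(j := 3 * c j + 1 - x j)) ` block c x I"
proof -
  let ?F = "\<lambda>h. h(j := 3 * c j + 1 - x j)"
  have x: "x j = c j \<or> x j = Suc (c j)" using assms by (auto simp: corner_def)
  have "h \<in> block c x I \<union> ?F ` block c x I" if h: "h \<in> block c x (insert j I)" for h
  proof (cases "h j = c j + x j")
    case True
    then have "h \<in> block c x I" using h assms by (simp add: block_def) metis
    then show ?thesis by blast
  next
    case False
    have "h j div 2 = c j" using h by (auto simp: block_def)
    then have "h j = 2 * c j \<or> h j = 2 * c j + 1" by presburger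
    then have "h j = 3 * c j + 1 - x j" using False x by auto
    then have "h = ?F (h(j := c j + x j))" by auto
    moreover have "h(j := c j + x j) \<in> block c x I" using h assms by (auto simp: block_def)
    ultimately show ?thesis by blast
  qed
  moreover have "h \<in> block c x (insert j I)" if "h \<in> block c x I" for h
  proof -
    have "h j = c j + x j" using that assms by (auto simp: block_def)
    then have "h j div 2 = c j" using x by auto
    then show ?thesis using that by (auto simp: block_def)
  qed
  moreover have "?F h \<in> block c x (insert j I)" if "h \<in> block c x I" for h
    using that x assms by (auto simp: block_def)
  ultimately show ?thesis by blast
qed

text \<open>
  The path enters the subcube \<open>g i\<close> at the vertex \<open>p i\<close>. In the finer grid the point \<open>x\<close> has the
  coordinates \<open>2 * x j\<close>. The vertex at which the path leaves the last subcube is left open: during the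
  induction it is the new direction that decides it. The fixed coordinates stay on the outer side
  \<open>2 * x j\<close>, so that there is room to climb twice in a new direction.
\<close>

definition grid_path ::
  "('n \<Rightarrow> nat) \<Rightarrow> ('n \<Rightarrow> nat) \<Rightarrow> 'n set \<Rightarrow> (nat \<Rightarrow> 'n \<Rightarrow> nat) \<Rightarrow> (nat \<Rightarrow> 'n \<Rightarrow> nat) \<Rightarrow> bool" where
  "grid_path c x I g p \<longleftrightarrow>
     bij_betw g {..<2 ^ card I} (block c x I) \<and> p 0 = (\<lambda>j. 2 * x j) \<and>
     (\<forall>i. Suc i < 2 ^ card I \<longrightarrow> adjacent (g i) (g (Suc i)) \<and> edge (g i) (p i) (p (Suc i))) \<and>
     corner (g (2 ^ card I - 1)) (p (2 ^ card I - 1)) \<and>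
     (\<forall>i < 2 ^ card I. \<forall>j. j \<notin> I \<longrightarrow> p i j = 2 * x j)"

text \<open>
  The reflection step of the Gray code, for cubes and vertices at the same time. With \<open>y\<close> for the
  value opposite to \<open>x j\<close>, the three lattice levels of coordinate \<open>j\<close> are \<open>2 * x j\<close>, \<open>x j + y\<close> and
  \<open>2 * y\<close>, and the two layers of cubes between them are numbered \<open>c j + x j\<close> and \<open>c j + y\<close>. The path
  stays at the first level up to the entry of the last cube, climbs to the second and then to the
  third level, and returns there. The return ends above the starting point, so the exit from
  the last cube is now known: it differs from the starting point in coordinate \<open>j\<close> alone.
\<close>

lemma grid_path_double:
  assumes x: "corner c x" and I: "finite I" "j \<notin> I" and G: "grid_path c x I g p"
  shows "\<exists>g' p'. grid_path c x (insert j I) g' p' \<and>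
           (\<forall>i < 2 ^ Suc (card I). edge (g' i) (p' i) (p' (Suc i))) \<and>
           p' (2 ^ Suc (card I)) = (\<lambda>i. 2 * (x(j := 2 * c j + 1 - x j)) i)"
proof -
  define N :: nat where "N = 2 ^ card I"
  have N: "N > 0" "2 ^ card (insert j I) = 2 * N" "2 ^ Suc (card I) = 2 * N"
    using I by (auto simp: N_def)
  define y where "y = 2 * c j + 1 - x j"
  have xj: "x j = c j \<or> x j = Suc (c j)" using x by (auto simp: corner_def)
  have bij: "bij_betw g {..<N} (block c x I)" and p0: "p 0 = (\<lambda>j. 2 * x j)"
    and adj: "\<And>i. Suc i < N \<Longrightarrow> adjacent (g i) (g (Suc i))"
    and edge: "\<And>i. Suc i < N \<Longrightarrow> edge (g i) (p i) (p (Suc i))"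
    and last: "corner (g (N - 1)) (p (N - 1))"
    and pj: "\<And>i k. i < N \<Longrightarrow> k \<notin> I \<Longrightarrow> p i k = 2 * x k"
    using G by (auto simp: grid_path_def N_def)
  have gj: "g i j = c j + x j" if "i < N" for i
  proof -
    have "g i \<in> block c x I" using bij that by (auto simp: bij_betw_def)
    then show ?thesis using I by (auto simp: block_def)
  qed
  \<comment> \<open>The return passes the cubes in reverse order, so cube \<open>N + m\<close> lies above cube \<open>N - 1 - m\<close>, and its
     entry above the exit \<open>p (N - m)\<close> of that cube; only the point \<open>p' N\<close> is at the middle level.\<close>
  define g' where "g' i = (if i < N then g i else (g (2 * N - 1 - i))(j := c j + y))" for i
  define p' where "p' i = (if i < N then p i else if i = N then (p (N - 1))(j := x j + y)
                           else (p (2 * N - i))(j := 2 * y))" for i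
  have y: "c j + y = 3 * c j + 1 - x j" "x j + y = 2 * c j + 1" using xj by (auto simp: y_def)
  have bij': "bij_betw g' {..<2 * N} (block c x (insert j I))"
  proof -
    let ?F = "\<lambda>h. h(j := 3 * c j + 1 - x j)"
    have "inj_on ?F (block c x I)"
    proof (rule inj_onI)
      fix a b assume ab: "a \<in> block c x I" "b \<in> block c x I" "?F a = ?F b"
      then have "a j = b j" using I by (auto simp: block_def)
      then show "a = b" using ab(3) by (auto simp: fun_eq_iff split: if_splits)
    qed
    then have "bij_betw ?F (block c x I) (?F ` block c x I)" by (rule inj_on_imp_bij_betw)
    moreover have "bij_betw (\<lambda>i. 2 * N - 1 - i) {N..<2 * N} {..<N}"
      by (rule bij_betwI[where g = "\<lambda>i. 2 * N - 1 - i"]) auto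
    ultimately have "bij_betw (?F \<circ> (g \<circ> (\<lambda>i. 2 * N - 1 - i))) {N..<2 * N} (?F ` block c x I)"
      using bij by (blast intro: bij_betw_trans)
    then have 2: "bij_betw g' {N..<2 * N} (?F ` block c x I)"
      by (rule bij_betw_cong[THEN iffD1, rotated]) (auto simp: g'_def y)
    have 1: "bij_betw g' {..<N} (block c x I)"
      using bij by (rule bij_betw_cong[THEN iffD1, rotated]) (auto simp: g'_def)
    have "block c x I \<inter> ?F ` block c x I = {}"
    proof -
      have "h j = c j + x j" if "h \<in> block c x I" for h
        using that I by (auto simp: block_def)
      moreover have "h j = 3 * c j + 1 - x j" if "h \<in> ?F ` block c x I" for h
        using that by auto
      moreover have "c j + x j \<noteq> 3 * c j + 1 - x j" using xj by auto
      ultimately show ?thesis by (metis disjoint_iff)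
    qed
    from bij_betw_combine[OF 1 2 this] show ?thesis
      unfolding block_insert[OF x I(2)] by (simp add: ivl_disj_un)
  qed
  have edge': "edge (g' i) (p' i) (p' (Suc i))" if i: "i < 2 * N" for i
  proof -
    consider "Suc i < N" | "Suc i = N" | "i = N" | "N < i" by linarith
    then show ?thesis
    proof cases
      case 1 then show ?thesis using edge by (auto simp: g'_def p'_def)
    next
      case 2
      then have "i = N - 1" by simp
      have "p i j = 2 * x j" "g i j = c j + x j" using pj gj I 2 by auto
      then have "p' (Suc i) = (p i)(j := 2 * g i j + 1 - p i j)"
        using 2 xj by (auto simp: p'_def y_def fun_eq_iff)
      then show ?thesis using 2 last \<open>i = N - 1\<close> by (auto simp: edge_def g'_def p'_def)
    next
      case 3
      have "corner ((g (N - 1))(j := c j + y)) ((p (N - 1))(j := x j + y))"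
        using last xj by (auto simp: corner_def y_def)
      moreover have "(p (N - 1))(j := 2 * y) = ((p (N - 1))(j := x j + y))
          (j := 2 * ((g (N - 1))(j := c j + y)) j + 1 - ((p (N - 1))(j := x j + y)) j)"
        using xj by (auto simp: y_def)
      moreover have "g' i = (g (N - 1))(j := c j + y)" "p' i = (p (N - 1))(j := x j + y)"
        "p' (Suc i) = (p (N - 1))(j := 2 * y)"
        using 3 N by (auto simp: g'_def p'_def mult_2)
      ultimately show ?thesis unfolding edge_def by metis
    next
      case 4
      define m where "m = 2 * N - 1 - i"
      have m: "Suc m < N" "2 * N - i = Suc m" "2 * N - Suc i = m" using 4 i by (auto simp: m_def)
      have "edge ((g m)(j := c j + y)) ((p (Suc m))(j := 2 * y)) ((p m)(j := 2 * y))"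
      proof (rule edge_fun_upd)
        show "edge (g m) (p (Suc m)) (p m)" using edge m edge_commute by blast
        show "p (Suc m) j = p m j" using pj I m by simp
        show "2 * y = c j + y \<or> 2 * y = Suc (c j + y)" using xj by (auto simp: y_def)
      qed
      then show ?thesis using 4 m i by (auto simp: g'_def p'_def m_def[symmetric])
    qed
  qed
  have adj': "adjacent (g' i) (g' (Suc i))" if i: "Suc i < 2 * N" for i
  proof -
    consider "Suc i < N" | "Suc i = N" | "N \<le> i" by linarith
    then show ?thesis
    proof cases
      case 1 then show ?thesis using adj by (auto simp: g'_def)
    next
      case 2
      have "2 * N - 1 - Suc i = i" using 2 by auto
      moreover have "g i j = c j + x j" using gj 2 by auto
      ultimately show ?thesis using 2 xj
        by (auto simp: g'_def adjacent_def y_def intro!: exI[of _ j])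
    next
      case 3
      define m where "m = 2 * N - 1 - Suc i"
      have m: "Suc m < N" "2 * N - 1 - i = Suc m" using 3 i by (auto simp: m_def)
      have "adjacent ((g (Suc m))(j := c j + y)) ((g m)(j := c j + y))"
        using adjacent_fun_upd[OF adjacent_commute[OF adj]] gj m by simp
      then show ?thesis using 3 m by (simp add: g'_def m_def)
    qed
  qed
  have "p' i k = 2 * x k" if "i < 2 * N" "k \<notin> insert j I" for i k
    using that pj N by (auto simp: p'_def)
  moreover have "p' 0 = (\<lambda>j. 2 * x j)" using p0 N by (simp add: p'_def)
  moreover have "corner (g' (2 * N - 1)) (p' (2 * N - 1))"
    using edge_start[OF edge'] N by simp
  ultimately have "grid_path c x (insert j I) g' p'"
    using bij' adj' edge' unfolding grid_path_def N by simp
  moreover have "p' (2 * N) = (\<lambda>i. 2 * (x(j := y)) i)"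
    using p0 N by (auto simp: p'_def)
  ultimately show ?thesis using edge' unfolding N y_def by blast
qed

lemma grid_path_exists:
  assumes "corner c x" "finite I"
  shows "\<exists>g p. grid_path c x I g p"
  using assms(2)
proof induction
  case empty
  have "block c x {} = {\<lambda>j. c j + x j}" by (auto simp: block_def)
  moreover have "{..<1::nat} = {0}" by auto
  ultimately have "bij_betw (\<lambda>(i::nat) j. c j + x j) {..<2 ^ card ({}::'a set)} (block c x {})"
    by (simp add: bij_betw_def inj_on_def flip: One_nat_def)
  moreover have "corner (\<lambda>j. c j + x j) (\<lambda>j. 2 * x j)"
    using assms(1) by (auto simp: corner_def)
  ultimately have "grid_path c x {} (\<lambda>i j. c j + x j) (\<lambda>i j. 2 * x j)"
    by (auto simp: grid_path_def)
  then show ?case by blast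
next
  case (insert j I)
  then show ?case using grid_path_double[OF assms(1)] by blast
qed

text \<open>
  A point of the coarse grid is a vertex of only one subcube of a given cube.
\<close>

lemma corner_child:
  assumes "corner c x" "h \<in> children c" "corner h (\<lambda>j. 2 * x j)"
  shows "h = (\<lambda>j. c j + x j)"
proof
  fix j
  have "x j = c j \<or> x j = Suc (c j)" "h j div 2 = c j" "2 * x j = h j \<or> 2 * x j = Suc (h j)"
    using assms by (auto simp: corner_def children_def)
  then show "h j = c j + x j" by presburger
qed

text \<open>
  Apart from the path itself, it matters where the first and the last subcube lie: their coordinates
  \<open>c + x\<close> and \<open>c + y\<close> make the paths in consecutive cubes fit together. The direction of the edge
  \<open>x y\<close> is the one that is added last in the induction, because that direction determines the exit.
\<close>

lemma subdivide_edge: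
  fixes c :: "'n::finite \<Rightarrow> nat"
  assumes "edge c x y"
  shows "\<exists>g p. bij_betw g {..<2 ^ CARD('n)} (children c) \<and>
           p 0 = (\<lambda>j. 2 * x j) \<and> p (2 ^ CARD('n)) = (\<lambda>j. 2 * y j) \<and>
           g 0 = (\<lambda>j. c j + x j) \<and> g (2 ^ CARD('n) - 1) = (\<lambda>j. c j + y j) \<and>
           (\<forall>i < 2 ^ CARD('n). edge (g i) (p i) (p (Suc i))) \<and>
           (\<forall>i. Suc i < 2 ^ CARD('n) \<longrightarrow> adjacent (g i) (g (Suc i)))"
proof -
  define N :: nat where "N = 2 ^ CARD('n)"
  obtain d where x: "corner c x" and y: "y = x(d := 2 * c d + 1 - x d)"
    using assms by (auto simp: edge_def)
  \<comment> \<open>The direction \<open>d\<close> is saved for the last application of \<open>grid_path_double\<close>.\<close>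
  let ?I = "UNIV - {d}"
  have ins: "insert d ?I = UNIV" by auto
  have card: "Suc (card ?I) = CARD('n)" by (simp add: card_Diff_singleton)
  obtain g0 p0 where "grid_path c x ?I g0 p0" using grid_path_exists[OF x, of ?I] by auto
  from grid_path_double[OF x _ _ this] obtain g p where
    G: "grid_path c x UNIV g p" and e: "\<forall>i < N. edge (g i) (p i) (p (Suc i))"
    and pN: "p N = (\<lambda>i. 2 * y i)" unfolding ins card y N_def by auto
  have "block c x UNIV = children c" by (auto simp: block_def children_def)
  then have bij: "bij_betw g {..<N} (children c)" and p: "p 0 = (\<lambda>j. 2 * x j)"
    and adj: "\<forall>i. Suc i < N \<longrightarrow> adjacent (g i) (g (Suc i))"
    using G by (auto simp: grid_path_def N_def)
  have N: "N > 0" by (simp add: N_def)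
  have ch: "g i \<in> children c" if "i < N" for i using bij that by (auto simp: bij_betw_def)
  have "g 0 = (\<lambda>j. c j + x j)"
    using corner_child[OF x ch] edge_start e N p by fastforce
  moreover have "corner (g (N - 1)) (\<lambda>j. 2 * y j)"
    using e[rule_format, of "N - 1"] N pN edge_end by fastforce
  then have "g (N - 1) = (\<lambda>j. c j + y j)"
    using corner_child[OF edge_end[OF assms] ch] N by auto
  ultimately show ?thesis using bij p pN e adj unfolding N_def by blast
qed

section \<open>The levels of the Hilbert curve\<close>

text \<open>
  The number \<open>2 ^ (CARD('n) * s)\<close> is that of the cubes of level \<open>s\<close> as well as that of the
  corresponding dyadic intervals.
\<close>

definition curve_level :: "nat \<Rightarrow> (nat \<Rightarrow> 'n \<Rightarrow> nat) \<Rightarrow> (nat \<Rightarrow> 'n \<Rightarrow> nat) \<Rightarrow> bool" where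
  "curve_level s c v \<longleftrightarrow>
     bij_betw c {..<2 ^ (CARD('n) * s)} {h. \<forall>j. h j < 2 ^ s} \<and>
     (\<forall>k < 2 ^ (CARD('n) * s). edge (c k) (v k) (v (Suc k))) \<and>
     (\<forall>k. Suc k < 2 ^ (CARD('n) * s) \<longrightarrow> adjacent (c k) (c (Suc k)))"

text \<open>
  The second level subdivides the first one: it passes through the same points at the times of the
  first level, and in between it visits exactly the subcubes of the cube visited by the first level.
\<close>

definition level_refines ::
  "nat \<Rightarrow> (nat \<Rightarrow> 'n \<Rightarrow> nat) \<Rightarrow> (nat \<Rightarrow> 'n \<Rightarrow> nat) \<Rightarrow> (nat \<Rightarrow> 'n \<Rightarrow> nat) \<Rightarrow> (nat \<Rightarrow> 'n \<Rightarrow> nat) \<Rightarrow> bool" where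
  "level_refines s c v c' v' \<longleftrightarrow>
     (\<forall>k \<le> 2 ^ (CARD('n) * s). v' (2 ^ CARD('n) * k) = (\<lambda>j. 2 * v k j)) \<and>
     (\<forall>k < 2 ^ (CARD('n) * s).
        bij_betw (\<lambda>i. c' (2 ^ CARD('n) * k + i)) {..<2 ^ CARD('n)} (children (c k)))"

lemma curve_level_0:
  "\<exists>c v :: nat \<Rightarrow> 'n::finite \<Rightarrow> nat. curve_level 0 c v"
proof -
  have "{h :: 'n \<Rightarrow> nat. \<forall>j. h j < 1} = {\<lambda>j. 0}" by auto
  moreover have "edge (\<lambda>j. 0) (\<lambda>j. 0) ((\<lambda>j::'n. 0)(undefined := 1))"
    by (auto simp: edge_def corner_def intro!: exI[of _ undefined])
  moreover have "{..<1::nat} = {0}" by auto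
  ultimately have "curve_level 0 (\<lambda>k j::'n. 0)
      (\<lambda>k. if k = 0 then (\<lambda>j. 0) else (\<lambda>j. 0)(undefined := 1))"
    by (simp add: curve_level_def bij_betw_def flip: One_nat_def)
  then show ?thesis by blast
qed

text \<open>
  Each cube is replaced by a path through its subcubes. At the passage from cube \<open>k\<close> to cube \<open>k + 1\<close>
  the two subcubes are \<open>c k + w\<close> and \<open>c (k + 1) + w\<close> for the common vertex \<open>w
    = v (k + 1)\<close>; adding \<open>w\<close>
  does not change the difference of \<open>c k\<close> and \<open>c (k + 1)\<close>, so they are adjacent.
\<close>

lemma curve_level_refine:
  fixes c v :: "nat \<Rightarrow> 'n::finite \<Rightarrow> nat"
  assumes "curve_level s c v"
  shows "\<exists>c' v'. curve_level (Suc s) c' v' \<and> level_refines s c v c' v'"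
proof -
  define N :: nat where "N = 2 ^ CARD('n)"
  define M :: nat where "M = 2 ^ (CARD('n) * s)"
  have N: "N > 0" by (simp add: N_def)
  have MN: "2 ^ (CARD('n) * Suc s) = N * M" by (simp add: N_def M_def power_add)
  have bij: "bij_betw c {..<M} {h. \<forall>j. h j < 2 ^ s}"
    and edge: "\<And>k. k < M \<Longrightarrow> edge (c k) (v k) (v (Suc k))"
    and adj: "\<And>k. Suc k < M \<Longrightarrow> adjacent (c k) (c (Suc k))"
    using assms by (auto simp: curve_level_def M_def)
  define P where "P k g p \<longleftrightarrow> bij_betw g {..<N} (children (c k)) \<and>
           p 0 = (\<lambda>j. 2 * v k j) \<and> p N = (\<lambda>j. 2 * v (Suc k) j) \<and>
           g 0 = (\<lambda>j. c k j + v k j) \<and> g (N - 1) = (\<lambda>j. c k j + v (Suc k) j) \<and>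
           (\<forall>i < N. edge (g i) (p i) (p (Suc i))) \<and>
           (\<forall>i. Suc i < N \<longrightarrow> adjacent (g i) (g (Suc i)))" for k g p
  have "\<forall>k. \<exists>g p. k < M \<longrightarrow> P k g p"
    using subdivide_edge[OF edge] unfolding P_def N_def by blast
  then obtain g p where P: "\<And>k. k < M \<Longrightarrow> P k (g k) (p k)" by metis
  \<comment> \<open>At a multiple of \<open>N\<close> the value of \<open>v'\<close> comes from \<open>v\<close> and not from \<open>p\<close>, so that it is also correct at
     the end of the last interval, where there is no further path.\<close>
  define c' where "c' m = g (m div N) (m mod N)" for m
  define v' where "v' m = (if m mod N
      = 0 then (\<lambda>j. 2 * v (m div N) j) else p (m div N) (m mod N))" for m
  have c': "c' (N * k + i) = g k i" if "i < N" for k i using that by (simp add: c'_def)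
  have v': "v' (N * k + i) = p k i" if "k < M" "i \<le> N" for k i
  proof (cases "i = N")
    case True
    then have "N * k + i = N * Suc k" by simp
    then have "v' (N * k + i) = (\<lambda>j. 2 * v (Suc k) j)"
      using N by (simp add: v'_def del: mult_Suc_right)
    then show ?thesis using P[OF that(1)] True by (simp add: P_def)
  next
    case False
    then show ?thesis using that P[OF that(1)] by (auto simp: v'_def P_def)
  qed
  have split: "\<exists>k i. m = N * k + i \<and> k < M \<and> i < N" if "m < N * M" for m
    using that N by (intro exI[of _ "m div N"] exI[of _ "m mod N"])
      (simp add: less_mult_imp_div_less mult.commute)
  have "edge (c' m) (v' m) (v' (Suc m))" if m: "m < N * M" for m
  proof -
    obtain k i where k: "m = N * k + i" "k < M" "i < N" using split[OF m] by blast
    then have "v' (Suc m) = p k (Suc i)" using v'[of k "Suc i"] by simp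
    then show ?thesis using k c' v' P[of k] by (auto simp: P_def)
  qed
  moreover have "adjacent (c' m) (c' (Suc m))" if m: "Suc m < N * M" for m
  proof -
    obtain k i where k: "m = N * k + i" "k < M" "i < N" using split[of m] m by auto
    show ?thesis
    proof (cases "Suc i < N")
      case True
      then have "c' (Suc m) = g k (Suc i)" using c'[of "Suc i" k] k by simp
      then show ?thesis using k c' P[of k] True by (auto simp: P_def)
    next
      case False
      then have "i = N - 1" "Suc m = N * Suc k + 0" using k by auto
      then have "N * Suc k < N * M" using m by simp
      then have "Suc k < M" by (simp del: mult_Suc_right)
      have "c' m = g k i" using k c' by simp
      then have "c' m = (\<lambda>j. c k j + v (Suc k) j)"
        using P[OF k(2)] \<open>i = N - 1\<close> by (simp add: P_def)
      moreover have "c' (Suc m) = (\<lambda>j. c (Suc k) j + v (Suc k) j)"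
        using c'[of 0 "Suc k"] P[OF \<open>Suc k < M\<close>] N \<open>Suc m = N * Suc k + 0\<close> by (simp add: P_def)
      moreover have "adjacent (c k) (c (Suc k))" using adj \<open>Suc k < M\<close> by blast
      ultimately show ?thesis by (auto simp: adjacent_def)
    qed
  qed
  moreover have "bij_betw c' {..<N * M} {h. \<forall>j. h j < 2 ^ Suc s}"
  proof (rule bij_betw_imageI)
    have div: "(\<lambda>j. g k i j div 2) = c k" if "k < M" "i < N" for k i
      using P[OF that(1)] that(2) by (auto simp: P_def bij_betw_def children_def)
    show "inj_on c' {..<N * M}"
    proof (rule inj_onI)
      fix m m' assume "m \<in> {..<N * M}" "m' \<in> {..<N * M}" and eq: "c' m = c' m'"
      then obtain k i k' i' where k: "m = N * k + i" "k < M" "i < N"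
        and k': "m' = N * k' + i'" "k' < M" "i' < N" using split by (metis lessThan_iff)
      have gg: "g k i = g k' i'" using eq k k' c' by simp
      then have "c k = c k'" using div k k' by metis
      then have "k = k'" using bij k k' by (auto simp: bij_betw_def inj_on_def)
      then have "i = i'" using gg P[of k] k k' by (auto simp: P_def bij_betw_def inj_on_def)
      then show "m = m'" using k k' \<open>k = k'\<close> by simp
    qed
    have "c' m j < 2 ^ Suc s" if m: "m < N * M" for m j
    proof -
      obtain k i where k: "m = N * k + i" "k < M" "i < N" using split[OF m] by blast
      have "c k j < 2 ^ s" using bij k by (auto simp: bij_betw_def)
      moreover have "c' m j div 2 = c k j" using div[OF k(2,3)] c' k by (auto simp: fun_eq_iff)
      ultimately show ?thesis by (auto simp: less_mult_imp_div_less)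
    qed
    moreover have "h \<in> c' ` {..<N * M}" if h: "\<forall>j. h j < 2 ^ Suc s" for h
    proof -
      have "\<forall>j. h j div 2 < 2 ^ s" using h by (auto simp: less_mult_imp_div_less mult.commute)
      then have "(\<lambda>j. h j div 2) \<in> c ` {..<M}" using bij by (auto simp: bij_betw_def)
      then obtain k where k: "k < M" "c k = (\<lambda>j. h j div 2)" by auto
      then have "h \<in> children (c k)" by (simp add: children_def)
      moreover have "g k ` {..<N} = children (c k)"
        using P[OF k(1)] by (simp add: P_def bij_betw_def)
      ultimately obtain i where i: "i < N" "h = g k i" by auto
      have "N * k + i < N * Suc k" using i by simp
      also have "\<dots> \<le> N * M" using k by (intro mult_le_mono2) simp
      finally show ?thesis using c' i by (metis imageI lessThan_iff)
    qed
    ultimately show "c' ` {..<N * M} = {h. \<forall>j. h j < 2 ^ Suc s}" by blast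
  qed
  ultimately have "curve_level (Suc s) c' v'" unfolding curve_level_def MN by blast
  moreover have "bij_betw (\<lambda>i. c' (N * k + i)) {..<N} (children (c k))" if "k < M" for k
  proof -
    have "bij_betw (g k) {..<N} (children (c k))" using P[OF that] by (simp add: P_def)
    then show ?thesis by (rule bij_betw_cong[THEN iffD1, rotated]) (simp add: c')
  qed
  moreover have "v' (N * k) = (\<lambda>j. 2 * v k j)" for k using N by (simp add: v'_def)
  ultimately show ?thesis unfolding level_refines_def N_def[symmetric] M_def[symmetric] by blast
qed

lemma curve_levels_exist:
  "\<exists>C V :: nat \<Rightarrow> nat \<Rightarrow> 'n::finite \<Rightarrow> nat.
     \<forall>s. curve_level s (C s) (V s) \<and> level_refines s (C s) (V s) (C (Suc s)) (V (Suc s))"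
proof -
  have "\<exists>f. \<forall>s. curve_level s (fst (f s)) (snd (f s :: (nat \<Rightarrow> 'n \<Rightarrow> nat) \<times> _)) \<and>
     level_refines s (fst (f s)) (snd (f s)) (fst (f (Suc s))) (snd (f (Suc s)))"
    by (rule dependent_nat_choice) (use curve_level_0 curve_level_refine in force)+
  then show ?thesis by (elim exE) (rule exI, rule exI)
qed

section \<open>Geometry of the dyadic cubes\<close>

definition grid_point :: "nat \<Rightarrow> ('n::finite \<Rightarrow> nat) \<Rightarrow> real ^ 'n" where
  "grid_point s h = (\<chi> j. real (h j) / 2 ^ s)"

definition grid_cube :: "nat \<Rightarrow> ('n::finite \<Rightarrow> nat) \<Rightarrow> (real ^ 'n) set" where
  "grid_cube s h = cbox (grid_point s h) (grid_point s (\<lambda>j. Suc (h j)))"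

lemma mem_grid_cube:
  "x \<in> grid_cube s h \<longleftrightarrow> (\<forall>j. real (h j) \<le> x $ j * 2 ^ s \<and> x $ j * 2 ^ s \<le> real (h j) + 1)"
  by (auto simp: grid_cube_def grid_point_def mem_box_cart field_simps)

lemma mem_interior_grid_cube:
  "x \<in> interior (grid_cube s h) \<longleftrightarrow> (\<forall>j. real (h j) < x $ j * 2 ^ s \<and> x $ j * 2 ^ s < real (h j) + 1)"
  by (auto simp: grid_cube_def grid_point_def mem_box_cart field_simps)

lemma grid_point_nth: "grid_point s h $ j * 2 ^ s = real (h j)"
  by (simp add: grid_point_def)

lemma corner_in_grid_cube: "corner h x \<Longrightarrow> grid_point s x \<in> grid_cube s h"
proof -
  assume x: "corner h x"
  have "real (h j) \<le> real (x j) \<and> real (x j) \<le> real (h j) + 1" for j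
    using x[unfolded corner_def, rule_format, of j] by auto
  then show ?thesis by (simp add: mem_grid_cube grid_point_nth)
qed

lemma grid_point_double: "grid_point (Suc s) (\<lambda>j. 2 * h j) = grid_point s h"
  by (simp add: grid_point_def vec_eq_iff)

lemma child_cube_subset:
  assumes "h' \<in> children h"
  shows "grid_cube (Suc s) h' \<subseteq> grid_cube s h"
proof
  fix x assume x: "x \<in> grid_cube (Suc s) h'"
  show "x \<in> grid_cube s h"
    unfolding mem_grid_cube
  proof
    fix j
    have "h' j div 2 = h j" using assms by (auto simp: children_def)
    then have "h' j = 2 * h j \<or> h' j = 2 * h j + 1" by presburger
    then show "real (h j) \<le> x $ j * 2 ^ s \<and> x $ j * 2 ^ s \<le> real (h j) + 1"
      using x[unfolded mem_grid_cube, rule_format, of j] by auto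
  qed
qed

lemma grid_cube_split:
  assumes "x \<in> grid_cube s h"
  shows "\<exists>h' \<in> children h. x \<in> grid_cube (Suc s) h'"
proof -
  define h' where "h' j
      = (if x $ j * 2 ^ Suc s \<le> 2 * real (h j) + 1 then 2 * h j else 2 * h j + 1)" for j
  have "x \<in> grid_cube (Suc s) h'"
    unfolding mem_grid_cube
  proof
    fix j
    show "real (h' j) \<le> x $ j * 2 ^ Suc s \<and> x $ j * 2 ^ Suc s \<le> real (h' j) + 1"
      using assms[unfolded mem_grid_cube, rule_format, of j] by (auto simp: h'_def)
  qed
  moreover have "h' \<in> children h" by (auto simp: children_def h'_def)
  ultimately show ?thesis by blast
qed

lemma dist_grid_cube:
  fixes x y :: "real ^ 'n"
  assumes "x \<in> grid_cube s h" "y \<in> grid_cube s h"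
  shows "dist x y \<le> real CARD('n) / 2 ^ s"
proof -
  have *: "\<bar>(x - y) $ j\<bar> \<le> 1 / 2 ^ s" for j
  proof -
    have "real (h j) \<le> x $ j * 2 ^ s" "x $ j * 2 ^ s \<le> real (h j) + 1"
      "real (h j) \<le> y $ j * 2 ^ s" "y $ j * 2 ^ s \<le> real (h j) + 1"
      using assms by (auto simp: mem_grid_cube)
    then have "\<bar>x $ j * 2 ^ s - y $ j * 2 ^ s\<bar> \<le> 1" by linarith
    moreover have "x $ j * 2 ^ s - y $ j * 2 ^ s = (x - y) $ j * 2 ^ s" by (simp add: algebra_simps)
    ultimately show ?thesis by (simp add: abs_mult pos_le_divide_eq)
  qed
  have "dist x y \<le> (\<Sum>j\<in>UNIV. \<bar>(x - y) $ j\<bar>)"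
    unfolding dist_norm by (rule norm_le_l1_cart)
  also have "\<dots> \<le> (\<Sum>j\<in>(UNIV::'n set). 1 / 2 ^ s)" by (rule sum_mono) (rule *)
  finally show ?thesis by simp
qed

text \<open>
  The integer coordinates of a cube are the integer parts of the coordinates of its interior points,
  so another cube of the same grid cannot reach into the interior.
\<close>

lemma interior_grid_cube_unique:
  assumes "x \<in> interior (grid_cube s h)" "x \<in> grid_cube s h'"
  shows "h' = h"
proof
  fix j
  have "real (h j) < x $ j * 2 ^ s" "x $ j * 2 ^ s < real (h j) + 1"
    "real (h' j) \<le> x $ j * 2 ^ s" "x $ j * 2 ^ s \<le> real (h' j) + 1"
    using assms by (auto simp: mem_interior_grid_cube mem_grid_cube)
  then show "h' j = h j" by linarith
qed

text \<open>
  This translates the coordinates of \<open>dyadic_cubes\<close>, which are indexed by basis vectors, into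
  components indexed by \<open>'n\<close>.
\<close>

lemma sum_Basis_cart:
  "(\<Sum>i\<in>Basis. g i *\<^sub>R i) = (\<chi> j::'n::finite. g (axis j (1::real)))"
proof (simp only: vec_eq_iff, intro allI)
  fix j :: 'n
  have "(\<Sum>i\<in>Basis. g i *\<^sub>R i) \<bullet> axis j 1 = g (axis j (1::real))"
    by (rule inner_sum_left_Basis) (simp add: axis_in_Basis_iff)
  then show "(\<Sum>i\<in>Basis. g i *\<^sub>R i) $ j = (\<chi> j. g (axis j 1)) $ j"
    by (simp only: cart_eq_inner_axis[symmetric] vec_lambda_beta)
qed

lemma dyadic_cubes_cart:
  "dyadic_cubes s = {grid_cube s h | h. \<forall>j::'n::finite. h j < 2 ^ s}"
proof -
  have eq: "cbox (\<Sum>i\<in>Basis. (real (k i) / 2 ^ s) *\<^sub>R i) (\<Sum>i\<in>Basis. ((real (k i) + 1) / 2 ^ s) *\<^sub>R i)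
      = grid_cube s (\<lambda>j::'n. k (axis j 1))" for k
    by (simp add: sum_Basis_cart grid_cube_def grid_point_def add.commute)
  have "\<exists>k. grid_cube s h = grid_cube s (\<lambda>j. k (axis j (1::real))) \<and> (\<forall>i\<in>Basis. k i < 2 ^ s)"
    if h: "\<forall>j. h j < 2 ^ s" for h :: "'n \<Rightarrow> nat"
  proof -
    have "inj (\<lambda>j::'n. axis j (1::real))" by (auto simp: inj_def axis_eq_axis)
    then have k: "h (inv (\<lambda>j. axis j (1::real)) (axis j 1)) = h j" for j by (subst inv_f_f) auto
    have "grid_cube s h = grid_cube s (\<lambda>j. h (inv (\<lambda>j. axis j (1::real)) (axis j 1)))"
      unfolding k ..
    then show ?thesis
      using h by (intro exI[of _ "\<lambda>b. h (inv (\<lambda>j. axis j 1) b)"]) blast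
  qed
  moreover have "\<forall>j::'n. k (axis j 1) < 2 ^ s" if "\<forall>i\<in>Basis. k i < 2 ^ s" for k :: "real ^ 'n \<Rightarrow> nat"
    using that by (simp add: axis_in_Basis_iff)
  ultimately show ?thesis unfolding dyadic_cubes_def eq by blast
qed

lemma dyadic_cubes_real:
  "dyadic_cubes m = {{real k / 2 ^ m..(real k + 1) / 2 ^ m} | k. k < 2 ^ m}" (is "_ = ?R")
proof -
  have eq: "dyadic_cubes m
      = {{real (f 1) / 2 ^ m..(real (f 1) + 1) / 2 ^ m} | f::real \<Rightarrow> nat. f 1 < 2 ^ m}"
    by (simp add: dyadic_cubes_def cbox_interval)
  have "{real k / 2 ^ m..(real k + 1) / 2 ^ m} \<in> dyadic_cubes m" if "k < 2 ^ m" for k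
    unfolding eq using that by (auto intro!: exI[of _ "\<lambda>_. k"])
  then show ?thesis unfolding eq by blast
qed

lemma Icc_in_dyadic_cubes:
  "{a..b} \<in> dyadic_cubes m \<longleftrightarrow> (\<exists>k < 2 ^ m. a = real k / 2 ^ m \<and> b = (real k + 1) / 2 ^ m)"
proof -
  have "real k / 2 ^ m \<le> (real k + 1) / 2 ^ m" for k by (simp add: divide_right_mono)
  then have "{a..b} = {real k / 2 ^ m..(real k + 1) / 2 ^ m} \<longleftrightarrow>
      a = real k / 2 ^ m \<and> b = (real k + 1) / 2 ^ m" for k
    unfolding Icc_eq_Icc by blast
  then show ?thesis unfolding dyadic_cubes_real by blast
qed

text \<open>
  The hyperplane supports the box, so it cuts out a face. To see that the face has codimension one,
  add one point \<open>p\<close> of the opposite side, above the point \<open>q\<close> of the face: translating the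
  face along the line through \<open>p\<close> and \<open>q\<close> sweeps out the box, so one additional point suffices to
  span the full dimension.
\<close>

lemma cbox_facet:
  fixes u v :: "real ^ 'n"
  assumes uv: "\<And>j. u $ j < v $ j" and h: "h = u $ d \<or> h = v $ d"
  shows "(cbox u v \<inter> {x. x $ d = h}) facet_of cbox u v"
proof -
  let ?F = "cbox u v \<inter> {x. x $ d = h}"
  have hyp: "{x. x $ d = h} = {x. axis d 1 \<bullet> x = h}"
    by (simp add: inner_axis')
  have le: "u $ d \<le> axis d 1 \<bullet> x" "axis d 1 \<bullet> x \<le> v $ d" if "x \<in> cbox u v" for x
    using that by (auto simp: mem_box_cart inner_axis' )
  have face: "?F face_of cbox u v"
    unfolding hyp using h face_of_Int_supporting_hyperplane_le[of "cbox u v" "axis d 1" h]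
      face_of_Int_supporting_hyperplane_ge[of "cbox u v" h "axis d 1"] le by auto
  \<comment> \<open>Since \<open>h\<close> is one of \<open>u $ d\<close> and \<open>v $ d\<close>, the other one is \<open>u $ d + v $ d - h\<close>.\<close>
  define p where "p = (\<chi> j. if j = d then u $ d + v $ d - h else u $ j)"
  define q where "q = (\<chi> j. if j = d then h else u $ j)"
  have q: "q \<in> ?F" using uv h by (auto simp: q_def mem_box_cart less_imp_le)
  have "cbox u v \<subseteq> affine hull (insert p ?F)"
  proof
    fix y assume y: "y \<in> cbox u v"
    define y' where "y' = (\<chi> j. if j = d then h else y $ j)"
    have "y' \<in> ?F" using y uv h by (auto simp: y'_def mem_box_cart less_imp_le)
    have "u $ d + v $ d - h - h \<noteq> 0" using h uv[of d] by auto
    then have "y = y' + ((y $ d - h) / (u $ d + v $ d - h - h)) *\<^sub>R (p - q)"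
      by (auto simp: vec_eq_iff y'_def p_def q_def)
    moreover have "y' + ((y $ d - h) / (u $ d + v $ d - h - h)) *\<^sub>R (p - q) \<in> affine hull (insert p ?F)"
      using \<open>y' \<in> ?F\<close> q by (intro mem_affine_3_minus) (auto intro: hull_inc)
    ultimately show "y \<in> affine hull (insert p ?F)" by simp
  qed
  from aff_dim_subset[OF this] have "aff_dim (cbox u v) \<le> aff_dim (insert p ?F)"
    unfolding aff_dim_affine_hull .
  also have "\<dots> \<le> aff_dim ?F + 1" by (simp add: aff_dim_insert)
  finally have "aff_dim (cbox u v) - 1 \<le> aff_dim ?F" by simp
  moreover have "aff_dim ?F \<le> aff_dim {x. axis d (1::real) \<bullet> x = h}"
    unfolding hyp by (rule aff_dim_subset) simp
  moreover have "aff_dim {x. axis d (1::real) \<bullet> x = h} = int CARD('n) - 1"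
    by (subst aff_dim_hyperplane) simp_all
  moreover have "aff_dim (cbox u v) = int CARD('n)"
  proof -
    have "box u v \<noteq> {}" using uv by (auto simp: interval_eq_empty_cart not_le)
    then show ?thesis using aff_dim_nonempty_interior[of "cbox u v"] by simp
  qed
  ultimately have "aff_dim ?F = aff_dim (cbox u v) - 1" by simp
  then show ?thesis using face q unfolding facet_of_def by blast
qed

text \<open>
  In each coordinate the point is a minimum or a maximum over the box, so a segment through it must
  be constant in each coordinate.
\<close>

lemma corner_extreme_point:
  fixes u v :: "real ^ 'n"
  assumes "x \<in> cbox u v" and "\<And>j. x $ j = u $ j \<or> x $ j = v $ j"
  shows "x extreme_point_of cbox u v"
  unfolding extreme_point_of_def
proof (intro conjI ballI notI)
  fix a b assume ab: "a \<in> cbox u v" "b \<in> cbox u v" "x \<in> open_segment a b"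
  then obtain r where r: "a \<noteq> b" "0 < r" "r < 1" and x: "x = (1 - r) *\<^sub>R a + r *\<^sub>R b"
    by (auto simp: in_segment)
  have "a $ j = b $ j" for j
  proof -
    have xj: "x $ j = (1 - r) * a $ j + r * b $ j" by (simp add: x)
    then have eq: "(1 - r) * (a $ j - x $ j) + r * (b $ j - x $ j) = 0"
      by (simp add: algebra_simps)
    have nonneg: "p = 0 \<and> q = 0" if "(1 - r) * p + r * q = 0" "0 \<le> p \<and> 0 \<le> q" for p q
      using that r by (simp add: add_nonneg_eq_0_iff)
    have *: "p = 0 \<and> q = 0" if "(1 - r) * p + r * q = 0" "0 \<le> p \<and> 0 \<le> q \<or> p \<le> 0 \<and> q \<le> 0" for p q
      using that nonneg[of p q] nonneg[of "- p" "- q"] by auto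
    have "0 \<le> a $ j - x $ j \<and> 0 \<le> b $ j - x $ j \<or> a $ j - x $ j \<le> 0 \<and> b $ j - x $ j \<le> 0"
      using assms(2)[of j] ab by (auto simp: mem_box_cart)
    from *[OF eq this] show ?thesis by simp
  qed
  then show False using r by (simp add: vec_eq_iff)
qed (rule assms(1))

text \<open>
  The common facet lies in the hyperplane between the two cubes. A vertex of both cubes lies in that
  hyperplane, and an extreme point of the cube which lies in a face is an extreme point of the face.
\<close>

lemma adjacent_cubes_common_facet:
  fixes a b :: "'n::finite \<Rightarrow> nat"
  assumes "adjacent a b" "corner a x" "corner b x"
  shows "\<exists>F. F facet_of grid_cube s a \<and> F facet_of grid_cube s b \<and>
             axis_cube (CARD('n) - 1) (1 / 2 ^ s) F \<and> grid_point s x extreme_point_of F"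
proof -
  have main: "\<exists>F. F facet_of grid_cube s a \<and> F facet_of grid_cube s b \<and>
             axis_cube (CARD('n) - 1) (1 / 2 ^ s) F \<and> grid_point s x extreme_point_of F"
    if d: "b d = Suc (a d)" "\<And>j. j \<noteq> d \<Longrightarrow> a j = b j" and x: "corner a x" "corner b x"
    for d and a b :: "'n \<Rightarrow> nat"
  proof -
    let ?H = "{y. y $ d = real (b d) / 2 ^ s}"
    let ?F = "grid_cube s a \<inter> ?H"
    have "y \<in> grid_cube s a \<longleftrightarrow> y \<in> grid_cube s b" if "y \<in> ?H" for y
    proof -
      have "(real (a j) \<le> y $ j * 2 ^ s \<and> y $ j * 2 ^ s \<le> real (a j) + 1) \<longleftrightarrow>
            (real (b j) \<le> y $ j * 2 ^ s \<and> y $ j * 2 ^ s \<le> real (b j) + 1)" for j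
        using that d by (cases "j = d") auto
      then show ?thesis by (simp add: mem_grid_cube)
    qed
    then have eq: "?F = grid_cube s b \<inter> ?H" by blast
    have fa: "?F facet_of grid_cube s a"
      unfolding grid_cube_def
        by (rule cbox_facet) (auto simp: grid_point_def d divide_strict_right_mono)
    have fb: "?F facet_of grid_cube s b"
      unfolding eq unfolding grid_cube_def
      by (rule cbox_facet) (auto simp: grid_point_def d divide_strict_right_mono)
    have "axis_cube (CARD('n) - 1) (1 / 2 ^ s) ?F"
      unfolding axis_cube_def
    proof (intro exI conjI)
      show "card (UNIV - {d}) = CARD('n) - 1" by simp
      have pointwise: "((\<forall>j. P j) \<and> e) = (\<forall>j. Q j)"
        if "Q d = e" "\<And>j. j \<noteq> d \<Longrightarrow> Q j = P j" "e \<Longrightarrow> P d" for P Q :: "'n \<Rightarrow> bool" and e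
        using that by metis
      show "?F = cbox (grid_point s (a(d := b d)))
        (grid_point s (a(d := b d)) + (\<chi> i. if i \<in> UNIV - {d} then 1 / 2 ^ s else 0))"
      proof (rule set_eqI)
        fix y
        have "y \<in> ?F \<longleftrightarrow> (\<forall>j. real (a j) / 2 ^ s \<le> y $ j \<and> y $ j \<le> (real (a j) + 1) / 2 ^ s)
            \<and> y $ d = real (b d) / 2 ^ s"
          by (simp add: grid_cube_def grid_point_def mem_box_cart add.commute)
        also have "\<dots> \<longleftrightarrow> (\<forall>j. real ((a(d := b d)) j) / 2 ^ s \<le> y $ j \<and>
             y $ j \<le> real ((a(d := b d)) j) / 2 ^ s + (if j \<in> UNIV - {d} then 1 / 2 ^ s else 0))"
        proof (rule pointwise)
          show "real (a d) / 2 ^ s \<le> y $ d \<and> y $ d \<le> (real (a d) + 1) / 2 ^ s"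
            if "y $ d = real (b d) / 2 ^ s"
            using that d(1) by (simp add: divide_right_mono)
        qed (auto simp add: add_divide_distrib)
        finally show "y \<in> ?F \<longleftrightarrow> y \<in> cbox (grid_point s (a(d := b d)))
          (grid_point s (a(d := b d)) + (\<chi> i. if i \<in> UNIV - {d} then 1 / 2 ^ s else 0))"
          by (simp add: grid_point_def mem_box_cart)
      qed
    qed
    moreover have "grid_point s x extreme_point_of ?F"
    proof -
      have "grid_point s x extreme_point_of grid_cube s a"
        unfolding grid_cube_def
      proof (rule corner_extreme_point)
        show "grid_point s x \<in> cbox (grid_point s a) (grid_point s (\<lambda>j. Suc (a j)))"
          using corner_in_grid_cube[OF x(1)] by (simp add: grid_cube_def)
        fix j
        have "x j = a j \<or> x j = Suc (a j)" using x by (simp add: corner_def)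
        then show "grid_point s x $ j = grid_point s a $ j \<or>
            grid_point s x $ j = grid_point s (\<lambda>j. Suc (a j)) $ j"
          by (auto simp: grid_point_def)
      qed
      moreover have "x d = b d" using x[unfolded corner_def, THEN spec, of d] d(1) by auto
      then have "grid_point s x \<in> ?F"
        using corner_in_grid_cube[OF x(1)] by (simp add: grid_point_def)
      ultimately show ?thesis using extreme_point_of_face[OF facet_of_imp_face_of[OF fa]] by blast
    qed
    ultimately show ?thesis using fa fb by blast
  qed
  obtain d where "a d = Suc (b d) \<or> b d = Suc (a d)" and d: "\<forall>j. j \<noteq> d \<longrightarrow> a j = b j"
    using assms(1) by (auto simp: adjacent_def)
  then consider "b d = Suc (a d)" | "a d = Suc (b d)" by blast
  then show ?thesis
  proof cases
    case 1 then show ?thesis using main[of b d a, OF 1 _ assms(2,3)] d by blast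
  next
    case 2
    have "b j = a j" if "j \<noteq> d" for j using d that by simp
    from main[of a d b, OF 2 this assms(3,2)] show ?thesis by blast
  qed
qed

section \<open>The limit curve\<close>

text \<open>
  With \<open>n\<close> the dimension, this says that each interval of level \<open>s\<close> splits into \<open>2 ^ (n * r)\<close>
  intervals of level \<open>s + r\<close>; the interval \<open>q\<close> lies in the interval \<open>q div 2 ^ (n * r)\<close>.
\<close>

lemma level_count_add:
  "(2 :: 'b::comm_semiring_1) ^ (n * (s + r)) = 2 ^ (n * r) * 2 ^ (n * s)"
  by (simp add: power_add distrib_left mult.commute)

locale hilbert_levels =
  fixes C V :: "nat \<Rightarrow> nat \<Rightarrow> 'n::finite \<Rightarrow> nat"
  assumes level: "curve_level s (C s) (V s)"
    and refine: "level_refines s (C s) (V s) (C (Suc s)) (V (Suc s))"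
begin

lemma cells_bij: "bij_betw (C s) {..<2 ^ (CARD('n) * s)} {h. \<forall>j. h j < 2 ^ s}"
  using level by (simp add: curve_level_def)

lemma cells_edge: "k < 2 ^ (CARD('n) * s) \<Longrightarrow> edge (C s k) (V s k) (V s (Suc k))"
  using level by (simp add: curve_level_def)

lemma cells_adjacent: "Suc k < 2 ^ (CARD('n) * s) \<Longrightarrow> adjacent (C s k) (C s (Suc k))"
  using level by (simp add: curve_level_def)

text \<open>
  At a time which belongs to level \<open>s\<close>, all finer levels are at the same point; hence the limit at this
  time is this point.
\<close>

lemma vertex_refine:
  "k \<le> 2 ^ (CARD('n) * s) \<Longrightarrow>
      grid_point (s + r) (V (s + r) (2 ^ (CARD('n) * r) * k)) = grid_point s (V s k)"
proof (induction r)
  case 0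
  then show ?case by simp
next
  case (Suc r)
  have "2 ^ (CARD('n) * r) * k \<le> 2 ^ (CARD('n) * (s + r))" using Suc.prems
    by (simp add: level_count_add)
  then have "V (Suc (s + r)) (2 ^ CARD('n) * (2 ^ (CARD('n) * r) * k))
      = (\<lambda>j. 2 * V (s + r) (2 ^ (CARD('n) * r) * k) j)"
    using refine[of "s + r"] unfolding level_refines_def by blast
  then show ?case using Suc.IH Suc.prems
    by (simp add: grid_point_double mult_ac power_add)
qed

lemma cell_children:
  "k < 2 ^ (CARD('n) * s) \<Longrightarrow>
      bij_betw (\<lambda>i. C (Suc s) (2 ^ CARD('n) * k + i)) {..<2 ^ CARD('n)} (children (C s k))"
  using refine[of s] unfolding level_refines_def by blast

lemma descendant_subset:
  "k < 2 ^ (CARD('n) * s) \<Longrightarrow> q div 2 ^ (CARD('n) * r) = k \<Longrightarrow>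
      q < 2 ^ (CARD('n) * (s + r)) \<and> grid_cube (s + r) (C (s + r) q) \<subseteq> grid_cube s (C s k)"
proof (induction r arbitrary: q)
  case 0
  then show ?case by simp
next
  case (Suc r)
  define N :: nat where "N = 2 ^ CARD('n)"
  have N: "N > 0" "2 ^ (CARD('n) * (Suc r)) = N * 2 ^ (CARD('n) * r)"
    "2 ^ (CARD('n) * (s + Suc r)) = 2 ^ (CARD('n) * (s + r)) * N"
    by (simp_all add: N_def power_add)
  have "q div N div 2 ^ (CARD('n) * r) = k" using Suc.prems(2) by (simp only: N(2) div_mult2_eq)
  from Suc.IH[OF Suc.prems(1) this]
  have q: "q div N < 2 ^ (CARD('n) * (s + r))"
    "grid_cube (s + r) (C (s + r) (q div N)) \<subseteq> grid_cube s (C s k)"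
    by auto
  have "q mod N < N" using N by simp
  then have "C (Suc (s + r)) (N * (q div N) + q mod N) \<in> children (C (s + r) (q div N))"
    using bij_betw_apply[OF cell_children[OF q(1)], of "q mod N"] by (simp add: N_def)
  then have "C (s + Suc r) q \<in> children (C (s + r) (q div N))" by simp
  moreover have "q < 2 ^ (CARD('n) * (s + r)) * N" using q(1) N(1)
    by (simp add: div_less_iff_less_mult)
  ultimately show ?case using q(2) child_cube_subset N(3) by fastforce
qed

lemma descendant_exists:
  "k < 2 ^ (CARD('n) * s) \<Longrightarrow> x \<in> grid_cube s (C s k) \<Longrightarrow>
      \<exists>q. q div 2 ^ (CARD('n) * r) = k \<and> x \<in> grid_cube (s + r) (C (s + r) q)"
proof (induction r)
  case 0
  then show ?case by simp
next
  case (Suc r)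
  define N :: nat where "N = 2 ^ CARD('n)"
  obtain q where q: "q div 2 ^ (CARD('n) * r) = k" "x \<in> grid_cube (s + r) (C (s + r) q)"
    using Suc by blast
  then have "q < 2 ^ (CARD('n) * (s + r))" using descendant_subset Suc.prems by blast
  from grid_cube_split[OF q(2)] obtain h where
    h: "h \<in> children (C (s + r) q)" "x \<in> grid_cube (Suc (s + r)) h" by blast
  from h(1) cell_children[OF \<open>q < 2 ^ (CARD('n) * (s + r))\<close>] obtain i where
    i: "i < N" "h = C (Suc (s + r)) (N * q + i)"
    by (auto simp: bij_betw_def N_def)
  have "2 ^ (CARD('n) * (Suc r)) = N * 2 ^ (CARD('n) * r)" by (simp add: N_def power_add)
  moreover have "(N * q + i) div N = q" using i by simp
  ultimately have "(N * q + i) div 2 ^ (CARD('n) * (Suc r)) = k" using q(1)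
    by (simp only: div_mult2_eq)
  then show ?case using h(2) i(2) by auto
qed

text \<open>
  The position at level \<open>m\<close> at the beginning of the interval that contains \<open>t\<close>. For \<open>t = 1\<close> the index is
  \<open>2 ^ (CARD('n) * m)\<close>, that of the final vertex.
\<close>

definition approx :: "real \<Rightarrow> nat \<Rightarrow> real ^ 'n" where
  "approx t m = grid_point m (V m (nat \<lfloor>t * 2 ^ (CARD('n) * m)\<rfloor>))"

definition curve :: "real \<Rightarrow> real ^ 'n" where
  "curve t = lim (approx t)"

text \<open>
  If \<open>t\<close> lies in the interval \<open>k\<close> but is not its right end, then the finer interval of \<open>t\<close> is a part
  of \<open>k\<close> and the cubes are nested; at the right end, all finer levels stay at the exit of the cube.
\<close>

lemma approx_in_cell:
  assumes k: "k < 2 ^ (CARD('n) * s)" and t: "real k \<le> t * 2 ^ (CARD('n) * s)"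
    "t * 2 ^ (CARD('n) * s) \<le> real k + 1"
  shows "approx t (s + r) \<in> grid_cube s (C s k)"
proof -
  define q where "q = nat \<lfloor>t * 2 ^ (CARD('n) * (s + r))\<rfloor>"
  have tR: "t * 2 ^ (CARD('n) * (s + r)) = (t * 2 ^ (CARD('n) * s)) * 2 ^ (CARD('n) * r)"
    by (simp add: level_count_add)
  have "real k * 2 ^ (CARD('n) * r) \<le> t * 2 ^ (CARD('n) * (s + r))" unfolding tR
    by (rule mult_right_mono[OF t(1)]) simp
  then have "real (k * 2 ^ (CARD('n) * r)) \<le> t * 2 ^ (CARD('n) * (s + r))" by simp
  then have lo: "k * 2 ^ (CARD('n) * r) \<le> q" unfolding q_def
    by (simp add: le_nat_floor del: of_nat_mult)
  have "t * 2 ^ (CARD('n) * (s + r)) \<le> (real k + 1) * 2 ^ (CARD('n) * r)" unfolding tR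
    by (rule mult_right_mono[OF t(2)]) simp
  also have "\<dots> = real (Suc k * 2 ^ (CARD('n) * r))" by (simp add: algebra_simps)
  finally have hi: "q \<le> Suc k * 2 ^ (CARD('n) * r)" unfolding q_def by linarith
  have a: "approx t (s + r) = grid_point (s + r) (V (s + r) q)" by (simp add: approx_def q_def)
  show ?thesis
  proof (cases "q = Suc k * 2 ^ (CARD('n) * r)")
    case True
    then have "approx t (s + r) = grid_point s (V s (Suc k))"
      using vertex_refine[of "Suc k" s r] k unfolding a by (simp add: mult.commute)
    then show ?thesis using corner_in_grid_cube[OF edge_end[OF cells_edge[OF k]]] by simp
  next
    case False
    then have "q div 2 ^ (CARD('n) * r) = k" using lo hi
      by (intro div_nat_eqI) (auto simp: mult.commute)
    from descendant_subset[OF k this] show ?thesis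
      using corner_in_grid_cube[OF edge_start[OF cells_edge]] unfolding a by blast
  qed
qed

lemma cell_exists:
  assumes "t \<in> {0..1}"
  obtains k where "k < 2 ^ (CARD('n) * s)" "real k \<le> t * 2 ^ (CARD('n) * s)"
    "t * 2 ^ (CARD('n) * s) \<le> real k + 1"
proof (cases "t = 1")
  case True
  then show ?thesis using that[of "2 ^ (CARD('n) * s) - 1"] by (simp add: of_nat_diff)
next
  case False
  then have "t * 2 ^ (CARD('n) * s) < 2 ^ (CARD('n) * s)" "0 \<le> t * 2 ^ (CARD('n) * s)"
    using assms by auto
  then show ?thesis using that[of "nat \<lfloor>t * 2 ^ (CARD('n) * s)\<rfloor>"]
    by (simp add: nat_less_iff floor_less_iff)
qed

lemma mesh_small:
  assumes "e > 0" shows "\<exists>s. a / 2 ^ s < (e::real)"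
proof -
  have "(\<lambda>s. a * (1 / 2) ^ s) \<longlonglongrightarrow> a * 0" by (intro tendsto_intros LIMSEQ_power_zero) simp
  then have "\<forall>\<^sub>F s in sequentially. a * (1 / 2) ^ s < e"
    using assms by (intro order_tendstoD(2)[of _ "a * 0"]) auto
  then obtain s where "a * (1 / 2) ^ s < e" by (auto simp: eventually_sequentially)
  moreover have "a * (1 / 2) ^ s = a / 2 ^ s" by (simp add: power_one_over)
  ultimately show ?thesis by metis
qed

lemma approx_tendsto:
  assumes "t \<in> {0..1}"
  shows "approx t \<longlonglongrightarrow> curve t"
proof -
  have "Cauchy (approx t)"
  proof (rule metric_CauchyI)
    fix e :: real assume "e > 0"
    then obtain s where s: "real CARD('n) / 2 ^ s < e" using mesh_small by blast
    obtain k where "k < 2 ^ (CARD('n) * s)" "real k \<le> t * 2 ^ (CARD('n) * s)"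
      "t * 2 ^ (CARD('n) * s) \<le> real k + 1"
      using cell_exists[OF assms] .
    then have "approx t m \<in> grid_cube s (C s k)" if "m \<ge> s" for m
      using approx_in_cell[of k s t "m - s"] that by simp
    then show "\<exists>M. \<forall>m\<ge>M. \<forall>n\<ge>M. dist (approx t m) (approx t n) < e"
      using dist_grid_cube s by (meson le_less_trans)
  qed
  then show ?thesis unfolding curve_def
    by (simp add: Cauchy_convergent convergent_LIMSEQ_iff[symmetric])
qed

lemma curve_in_cell:
  assumes "k < 2 ^ (CARD('n) * s)" "real k \<le> t * 2 ^ (CARD('n) * s)"
    "t * 2 ^ (CARD('n) * s) \<le> real k + 1" "t \<in> {0..1}"
  shows "curve t \<in> grid_cube s (C s k)"
proof (rule closed_sequentially)
  show "closed (grid_cube s (C s k))" by (simp add: grid_cube_def closed_cbox)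
  show "(\<lambda>r. approx t (r + s)) \<longlonglongrightarrow> curve t"
    using approx_tendsto[OF assms(4)] by (rule LIMSEQ_ignore_initial_segment)
  show "approx t (r + s) \<in> grid_cube s (C s k)" for r
    using approx_in_cell[OF assms(1-3), of r] by (simp add: add.commute)
qed

lemma curve_vertex:
  assumes "k \<le> 2 ^ (CARD('n) * s)"
  shows "curve (real k / 2 ^ (CARD('n) * s)) = grid_point s (V s k)"
proof -
  have eq: "approx (real k / 2 ^ (CARD('n) * s)) (r + s) = grid_point s (V s k)" for r
  proof -
    have "real k / 2 ^ (CARD('n) * s) * 2 ^ (CARD('n) * (s + r)) = real (2 ^ (CARD('n) * r) * k)"
      by (simp add: level_count_add)
    then have "nat \<lfloor>real k / 2 ^ (CARD('n) * s) * 2 ^ (CARD('n) * (s + r))\<rfloor>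
        = 2 ^ (CARD('n) * r) * k" by (simp only: floor_of_nat nat_int)
    then show ?thesis using vertex_refine[OF assms, of r] by (simp add: approx_def add.commute)
  qed
  have "approx (real k / 2 ^ (CARD('n) * s)) \<longlonglongrightarrow> grid_point s (V s k)"
    by (rule LIMSEQ_offset[of _ s]) (simp only: eq tendsto_const)
  then show ?thesis unfolding curve_def by (rule limI)
qed

text \<open>
  Two times at a distance less than one interval length lie in the same interval or in consecutive
  ones, and the cubes of consecutive intervals have the vertex \<open>V s (k + 1)\<close> in common.
\<close>

lemma curve_dist:
  assumes "t \<in> {0..1}" "u \<in> {0..1}" "t \<le> u" "(u - t) * 2 ^ (CARD('n) * s) < 1"
  shows "dist (curve t) (curve u) \<le> 2 * real CARD('n) / 2 ^ s"
proof -
  obtain k where k: "k < 2 ^ (CARD('n) * s)" "real k \<le> t * 2 ^ (CARD('n) * s)"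
    "t * 2 ^ (CARD('n) * s) \<le> real k + 1"
    using cell_exists[OF assms(1)] .
  have tu: "t * 2 ^ (CARD('n) * s) \<le> u * 2 ^ (CARD('n) * s)" using assms(3)
    by (simp add: mult_right_mono)
  have t: "curve t \<in> grid_cube s (C s k)" using curve_in_cell k assms(1) by blast
  have n: "real CARD('n) / 2 ^ s \<ge> 0"
    "2 * real CARD('n) / 2 ^ s = real CARD('n) / 2 ^ s + real CARD('n) / 2 ^ s"
    by simp_all
  show ?thesis
  proof (cases "u * 2 ^ (CARD('n) * s) \<le> real k + 1")
    case True
    then have "curve u \<in> grid_cube s (C s k)" 
      by (intro curve_in_cell[OF k(1) _ True assms(2)]) (use k(2) tu in linarith)
    from dist_grid_cube[OF t this] n show ?thesis by linarith
  next
    case False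
    have "u * 2 ^ (CARD('n) * s) \<le> 2 ^ (CARD('n) * s)" using assms(2)
      by (simp add: mult_left_le_one_le)
    then have "real k + 1 < 2 ^ (CARD('n) * s)" using False by linarith
    then have "real (Suc k) < real (2 ^ (CARD('n) * s))" by simp
    then have k': "Suc k < 2 ^ (CARD('n) * s)" by (simp only: of_nat_less_iff)
    have "u * 2 ^ (CARD('n) * s) < real (Suc k) + 1" using assms(4) k(3)
      by (simp add: algebra_simps)
    then have u: "curve u \<in> grid_cube s (C s (Suc k))"
      using False by (intro curve_in_cell[OF k' _ _ assms(2)]) auto
    let ?v = "grid_point s (V s (Suc k))"
    have "?v \<in> grid_cube s (C s k)" "?v \<in> grid_cube s (C s (Suc k))"
      using corner_in_grid_cube[OF edge_end[OF cells_edge[OF k(1)]]]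
        corner_in_grid_cube[OF edge_start[OF cells_edge[OF k']]] by simp_all
    from dist_grid_cube[OF t this(1)] dist_grid_cube[OF this(2) u] show ?thesis
      using dist_triangle[of "curve t" "curve u" ?v] n(2) by linarith
  qed
qed

lemma continuous_curve: "continuous_on {0..1} curve"
  unfolding continuous_on_iff
proof (intro ballI allI impI)
  fix t e :: real assume t: "t \<in> {0..1}" and "e > 0"
  then obtain s where s: "2 * real CARD('n) / 2 ^ s < e" using mesh_small by blast
  have "dist (curve u) (curve t) < e" if u: "u \<in> {0..1}" "dist u t < 1 / 2 ^ (CARD('n) * s)" for u
  proof -
    have *: "\<bar>u - t\<bar> * 2 ^ (CARD('n) * s) < 1" using u(2) by (simp add: dist_real_def field_simps)
    have "dist (curve u) (curve t) \<le> 2 * real CARD('n) / 2 ^ s"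
    proof (cases "t \<le> u")
      case True
      then show ?thesis using curve_dist[OF t u(1)] * by (simp add: dist_commute)
    next
      case False
      then show ?thesis using curve_dist[OF u(1) t] * by simp
    qed
    then show ?thesis using s by simp
  qed
  then show "\<exists>d>0. \<forall>u\<in>{0..1}. dist u t < d \<longrightarrow> dist (curve u) (curve t) < e"
    by (intro exI[of _ "1 / 2 ^ (CARD('n) * s)"]) auto
qed

lemma dyadic_interval_iff:
  assumes "k < 2 ^ (CARD('n) * s)"
  shows "t \<in> {real k / 2 ^ (CARD('n) * s)..(real k + 1) / 2 ^ (CARD('n) * s)} \<longleftrightarrow>
    t \<in> {0..1} \<and> real k \<le> t * 2 ^ (CARD('n) * s) \<and> t * 2 ^ (CARD('n) * s) \<le> real k + 1"
proof -
  have "real (Suc k) \<le> real (2 ^ (CARD('n) * s))"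
    using assms by (simp only: of_nat_le_iff Suc_le_eq)
  then have "real k + 1 \<le> 2 ^ (CARD('n) * s)" by simp
  then have "(real k + 1) / 2 ^ (CARD('n) * s) \<le> 1" by simp
  moreover have "0 \<le> real k / 2 ^ (CARD('n) * s)" by simp
  ultimately have "t \<in> {0..1}" if "t \<in> {real k / 2 ^ (CARD('n) * s)..(real k + 1) / 2 ^ (CARD('n) * s)}"
    using that unfolding atLeastAtMost_iff by linarith
  moreover have "t \<in> {real k / 2 ^ (CARD('n) * s)..(real k + 1) / 2 ^ (CARD('n) * s)}
      \<longleftrightarrow> real k \<le> t * 2 ^ (CARD('n) * s) \<and> t * 2 ^ (CARD('n) * s) \<le> real k + 1"
    by (simp add: pos_divide_le_eq pos_le_divide_eq)
  ultimately show ?thesis by blast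
qed

text \<open>
  The descendants of the interval \<open>k\<close> at a deep level visit all the small subcubes of the cube, so the
  image of the interval is dense in the cube; and it is closed.
\<close>

lemma curve_image_cell:
  assumes k: "k < 2 ^ (CARD('n) * s)"
  shows "curve ` {real k / 2 ^ (CARD('n) * s)..(real k + 1) / 2 ^ (CARD('n) * s)}
      = grid_cube s (C s k)" (is "curve ` ?I = ?C")
proof
  show "curve ` ?I \<subseteq> ?C"
    using curve_in_cell[OF k] dyadic_interval_iff[OF k] by blast
  have "?I \<subseteq> {0..1}" using dyadic_interval_iff[OF k] by blast
  then have "compact (curve ` ?I)"
    by (intro compact_continuous_image continuous_on_subset[OF continuous_curve]) auto
  then have closed: "closed (curve ` ?I)" by (rule compact_imp_closed)
  show "?C \<subseteq> curve ` ?I"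
  proof
    fix x assume x: "x \<in> ?C"
    have "x \<in> closure (curve ` ?I)"
      unfolding closure_approachable
    proof (intro allI impI)
      fix e :: real assume "e > 0"
      then obtain r where r: "real CARD('n) / 2 ^ r < e" using mesh_small by blast
      obtain q where q: "q div 2 ^ (CARD('n) * r) = k" "x \<in> grid_cube (s + r) (C (s + r) q)"
        using descendant_exists[OF k x] by blast
      then have qR: "q < 2 ^ (CARD('n) * (s + r))" using descendant_subset[OF k] by blast
      let ?y = "grid_point (s + r) (V (s + r) q)"
      have "?y \<in> grid_cube (s + r) (C (s + r) q)"
        using corner_in_grid_cube edge_start cells_edge[OF qR] by blast
      from dist_grid_cube[OF this q(2)] have "dist ?y x \<le> real CARD('n) / 2 ^ (s + r)" .
      also have "\<dots> \<le> real CARD('n) / 2 ^ r"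
        by (intro divide_left_mono) (auto intro: power_increasing)
      finally have "dist ?y x < e" using r by simp
      moreover have "?y = curve (real q / 2 ^ (CARD('n) * (s + r)))" using curve_vertex qR by simp
      moreover have "real q / 2 ^ (CARD('n) * (s + r)) \<in> ?I"
      proof -
        have "k * 2 ^ (CARD('n) * r) \<le> q" using q(1) by (metis div_times_less_eq_dividend)
        moreover have "q \<le> Suc k * 2 ^ (CARD('n) * r)"
          using q(1) dividend_less_times_div[of "2 ^ (CARD('n) * r)" q] by (simp add: mult.commute)
        ultimately have "real (k * 2 ^ (CARD('n) * r)) \<le> real q"
          "real q \<le> real (Suc k * 2 ^ (CARD('n) * r))"
          by (simp_all only: of_nat_le_iff)
        then have "real (k * 2 ^ (CARD('n) * r)) / 2 ^ (CARD('n) * (s + r))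
            \<le> real q / 2 ^ (CARD('n) * (s + r))"
          "real q / 2 ^ (CARD('n) * (s + r))
              \<le> real (Suc k * 2 ^ (CARD('n) * r)) / 2 ^ (CARD('n) * (s + r))"
          by (auto intro: divide_right_mono simp del: of_nat_mult of_nat_le_iff)
        moreover have eq: "real (m * 2 ^ (CARD('n) * r)) / 2 ^ (CARD('n) * (s + r))
            = real m / 2 ^ (CARD('n) * s)" for m
          by (simp add: level_count_add)
        ultimately show ?thesis unfolding eq by (simp add: add.commute)
      qed
      ultimately show "\<exists>y\<in>curve ` ?I. dist y x < e" by auto
    qed
    then show "x \<in> curve ` ?I" using closed by simp
  qed
qed

lemma dyadic_interval_E:
  assumes "A \<in> dyadic_cubes (CARD('n) * s)"
  obtains k where "k < 2 ^ (CARD('n) * s)"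
    "A = {real k / 2 ^ (CARD('n) * s)..(real k + 1) / 2 ^ (CARD('n) * s)}"
  using assms unfolding dyadic_cubes_real by blast

lemma cell_in_dyadic_cubes: "k < 2 ^ (CARD('n) * s) \<Longrightarrow> grid_cube s (C s k) \<in> dyadic_cubes s"
  using cells_bij[of s] by (auto simp: dyadic_cubes_cart bij_betw_def)

lemma dyadic_cube_E:
  assumes "D \<in> dyadic_cubes s"
  obtains k where "k < 2 ^ (CARD('n) * s)" "D = grid_cube s (C s k)"
proof -
  obtain h :: "'n \<Rightarrow> nat" where h: "D = grid_cube s h" "\<forall>j. h j < 2 ^ s"
    using assms by (auto simp: dyadic_cubes_cart)
  then have "h \<in> C s ` {..<2 ^ (CARD('n) * s)}" using cells_bij[of s] by (auto simp: bij_betw_def)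
  then show ?thesis using that h by auto
qed

lemma curve_image: "curve ` {0..1} = cbox 0 1"
proof -
  have "C 0 0 = (\<lambda>j. 0)" using cells_bij[of 0] by (auto simp: bij_betw_def fun_eq_iff)
  then have "grid_cube 0 (C 0 0) = cbox 0 1"
    by (simp add: grid_cube_def grid_point_def zero_vec_def one_vec_def)
  then show ?thesis using curve_image_cell[of 0 0] by simp
qed

text \<open>
  For the second condition, a time with a value in the interior of the cube \<open>k\<close> lies in an interval
  \<open>k'\<close> whose cube contains the same value; hence the cubes coincide, and so do their numbers.
\<close>

lemma cubes_preserving_curve: "cubes_preserving curve"
  unfolding cubes_preserving_def
proof (intro conjI allI ballI)
  show "curve ` {0..1} \<subseteq> cbox 0 1" by (simp add: curve_image)
next
  fix s and A :: "real set" assume "A \<in> dyadic_cubes (CARD('n) * s)"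
  then obtain k where k: "k < 2 ^ (CARD('n) * s)"
    and A: "A = {real k / 2 ^ (CARD('n) * s)..(real k + 1) / 2 ^ (CARD('n) * s)}"
    by (rule dyadic_interval_E)
  then show "\<exists>D\<in>dyadic_cubes s. curve ` A \<subseteq> D"
    unfolding A curve_image_cell[OF k] using cell_in_dyadic_cubes[OF k] by blast
next
  fix s and D :: "(real ^ 'n) set" assume "D \<in> dyadic_cubes s"
  then obtain k where k: "k < 2 ^ (CARD('n) * s)" "D = grid_cube s (C s k)" by (rule dyadic_cube_E)
  have "t \<in> {real k / 2 ^ (CARD('n) * s)..(real k + 1) / 2 ^ (CARD('n) * s)}"
    if t: "t \<in> {0..1}" "curve t \<in> interior D" for t
  proof -
    obtain k' where k': "k' < 2 ^ (CARD('n) * s)" "real k' \<le> t * 2 ^ (CARD('n) * s)"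
      "t * 2 ^ (CARD('n) * s) \<le> real k' + 1"
      using cell_exists[OF t(1)] .
    then have "C s k' = C s k"
      using interior_grid_cube_unique[OF _ curve_in_cell[OF k' t(1)]] t(2) unfolding k(2) by simp
    then have "k' = k" using cells_bij[of s] k k' by (auto simp: bij_betw_def inj_on_def)
    then show ?thesis using dyadic_interval_iff[OF k(1)] k' t(1) by blast
  qed
  moreover have "{real k / 2 ^ (CARD('n) * s)..(real k + 1) / 2 ^ (CARD('n) * s)} \<in> dyadic_cubes (CARD('n) * s)"
    using k(1) by (auto simp: dyadic_cubes_real)
  ultimately show "\<exists>A\<in>dyadic_cubes (CARD('n) * s). {t \<in> {0..1}. curve t \<in> interior D} \<subseteq> A"
    by blast
qed

lemma curve_consecutive:
  assumes ab: "{a..b} \<in> dyadic_cubes (CARD('n) * s)" and bc: "{b..c} \<in> dyadic_cubes (CARD('n) * s)"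
  shows "curve ` {a..b} \<in> dyadic_cubes s \<and> curve ` {b..c} \<in> dyadic_cubes s \<and>
    (\<exists>F. F facet_of curve ` {a..b} \<and> F facet_of curve ` {b..c} \<and>
       axis_cube (CARD('n) - 1) (1 / 2 ^ s) F \<and> curve b extreme_point_of F)"
proof -
  obtain k where k: "k < 2 ^ (CARD('n) * s)" "a = real k / 2 ^ (CARD('n) * s)"
    "b = (real k + 1) / 2 ^ (CARD('n) * s)"
    using ab[unfolded Icc_in_dyadic_cubes] by auto
  obtain l where l: "l < 2 ^ (CARD('n) * s)" "b = real l / 2 ^ (CARD('n) * s)"
    "c = (real l + 1) / 2 ^ (CARD('n) * s)"
    using bc[unfolded Icc_in_dyadic_cubes] by auto
  have "real l = real k + 1" using k(3) l(2) by simp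
  then have "l = Suc k" by linarith
  have "curve ` {a..b} = grid_cube s (C s k)" using curve_image_cell[OF k(1)] k by simp
  moreover have "curve ` {b..c} = grid_cube s (C s (Suc k))"
    using curve_image_cell[OF l(1)] l \<open>l = Suc k\<close> by simp
  moreover have "curve b = grid_point s (V s (Suc k))"
    using curve_vertex[of l s] l \<open>l = Suc k\<close> by simp
  moreover have "adjacent (C s k) (C s (Suc k))" "corner (C s k) (V s (Suc k))"
    "corner (C s (Suc k)) (V s (Suc k))"
    using cells_adjacent cells_edge edge_end edge_start k(1) l(1) \<open>l = Suc k\<close> by blast+
  ultimately show ?thesis
    using adjacent_cubes_common_facet cell_in_dyadic_cubes k(1) l(1) \<open>l = Suc k\<close> by simp
qed

end

theorem theorem4:
  "\<exists>f :: real \<Rightarrow> real ^ 'n.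
     continuous_on {0..1} f \<and>
     cubes_preserving f \<and>
     f ` {0..1} = cbox 0 1 \<and>
     (\<forall>s a b c. {a..b} \<in> dyadic_cubes (CARD('n) * s) \<and> {b..c} \<in> dyadic_cubes (CARD('n) * s) \<longrightarrow>
        f ` {a..b} \<in> dyadic_cubes s \<and>
        f ` {b..c} \<in> dyadic_cubes s \<and>
        (\<exists>F. F facet_of f ` {a..b} \<and> F facet_of f ` {b..c} \<and>
             axis_cube (CARD('n) - 1) (1 / 2 ^ s) F \<and>
             f b extreme_point_of F))"
proof -
  obtain C V :: "nat \<Rightarrow> nat \<Rightarrow> 'n \<Rightarrow> nat" where
    "\<forall>s. curve_level s (C s) (V s) \<and> level_refines s (C s) (V s) (C (Suc s)) (V (Suc s))"
    using curve_levels_exist by blast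
  then interpret hilbert_levels C V by unfold_locales blast+
  show ?thesis
    using continuous_curve cubes_preserving_curve curve_image curve_consecutive
    by (intro exI[of _ curve]) blast
qed

end
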